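(* Let $\Omega$ be an infinite set. The index map $\mathrm{Ind}:\mathbb{G}_\Omega\to\mathbb{Z}$, $[f]\mapsto\mathrm{ind}(f)$, is a group homomorphism.
   Context: For $A\subseteq\Omega$ write $A'=\Omega\setminus A$; $A$ is cofinite if $A'$ is finite. $|A|$ denotes the cardinality of a finite set $A$. A function $f:\Omega\to\Omega$ is a near-bijection if there exist cofinite subsets $A,B\subseteq\Omega$ such that $f$ restricts to a bijection $A\to B$. The monoset of $f$ is $\Omega_f=\{\omega\in\Omega:\ f^{-1}(\{f(\omega)\})=\{\omega\}\}$, where $f^{-1}(B)$ denotes the preimage of $B$. For a near-bijection $f$, both $\Omega_f'$ and $f(\Omega)'$ are finite and $\mathrm{ind}(f)=\big(|\Omega_f'|-|f(\Omega_f')|\big)-|f(\Omega)'|\in\mathbb{Z}$. For self-maps $f,g$ of $\Omega$, $f\equiv g$ (almost equal) means that $\{\omega: f(\omega)\neq g(\omega)\}$ is finite. $\mathbb{G}_\Omega$ is the group whose elements are the $\equiv$-classes $[f]$ of near-bijections $f$ of $\Omega$, with operation $[g][f]=[g\circ f]$. The index is constant on $\equiv$-classes of near-bijections, so it descends to the map $\mathrm{Ind}:\mathbb{G}_\Omega\to\mathbb{Z}$, $\mathrm{Ind}[f]=\mathrm{ind}(f)$. The group $\mathbb{Z}$ is taken with addition. *)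

theory Defs
  imports "HOL-Algebra.Elementary_Groups" "HOL-Library.FuncSet"
begin

text \<open>Self-maps of a carrier set \<open>\<Omega>\<close> are represented by the extensional function space
  \<open>\<Omega> \<rightarrow>\<^sub>E \<Omega>\<close>, so that HOL equality of two such functions is equality as maps on \<open>\<Omega>\<close>.\<close>

definition cofinite_in :: "'a set \<Rightarrow> 'a set \<Rightarrow> bool" where
  "cofinite_in \<Omega> A \<longleftrightarrow> A \<subseteq> \<Omega> \<and> finite (\<Omega> - A)"

definition near_bijections :: "'a set \<Rightarrow> ('a \<Rightarrow> 'a) set" where
  "near_bijections \<Omega> =
     {f \<in> \<Omega> \<rightarrow>\<^sub>E \<Omega>. \<exists>A B. cofinite_in \<Omega> A \<and> cofinite_in \<Omega> B \<and> bij_betw f A B}"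

definition monoset :: "'a set \<Rightarrow> ('a \<Rightarrow> 'a) \<Rightarrow> 'a set" where
  "monoset \<Omega> f = {\<omega> \<in> \<Omega>. f -` {f \<omega>} \<inter> \<Omega> = {\<omega>}}"

text \<open>All three sets below are finite when \<open>f\<close> is a near-bijection; for other \<open>f\<close> the value
  is meaningless, because \<open>card\<close> of an infinite set is \<open>0\<close>.\<close>

definition ind :: "'a set \<Rightarrow> ('a \<Rightarrow> 'a) \<Rightarrow> int" where
  "ind \<Omega> f =
     (int (card (\<Omega> - monoset \<Omega> f)) - int (card (f ` (\<Omega> - monoset \<Omega> f))))
       - int (card (\<Omega> - f ` \<Omega>))"

definition almost_equal :: "'a set \<Rightarrow> (('a \<Rightarrow> 'a) \<times> ('a \<Rightarrow> 'a)) set" where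
  "almost_equal \<Omega> =
     {(f, g). f \<in> \<Omega> \<rightarrow>\<^sub>E \<Omega> \<and> g \<in> \<Omega> \<rightarrow>\<^sub>E \<Omega> \<and> finite {\<omega> \<in> \<Omega>. f \<omega> \<noteq> g \<omega>}}"

definition ae_class :: "'a set \<Rightarrow> ('a \<Rightarrow> 'a) \<Rightarrow> ('a \<Rightarrow> 'a) set" where
  "ae_class \<Omega> f = almost_equal \<Omega> `` {f}"

text \<open>The product of two classes is the union of the classes of \<open>g \<circ> f\<close> over all
  representatives. These classes all coincide for near-bijections, so the union is the single
  class of \<open>g \<circ> f\<close>; the composite is taken with \<^const>\<open>compose\<close> to stay extensional.\<close>

definition near_bij_group :: "'a set \<Rightarrow> ('a \<Rightarrow> 'a) set monoid" where
  "near_bij_group \<Omega> =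
     \<lparr>carrier = ae_class \<Omega> ` near_bijections \<Omega>,
      monoid.mult = (\<lambda>Y X. \<Union>g\<in>Y. \<Union>f\<in>X. ae_class \<Omega> (compose \<Omega> g f)),
      one = ae_class \<Omega> (\<lambda>\<omega>\<in>\<Omega>. \<omega>)\<rparr>"

text \<open>The common value of \<^const>\<open>ind\<close> on the members of a class;
  \<^const>\<open>the_elem\<close> is specified only when that value is unique.\<close>

definition Ind :: "'a set \<Rightarrow> ('a \<Rightarrow> 'a) set \<Rightarrow> int" where
  "Ind \<Omega> X = the_elem (ind \<Omega> ` X)"

end

theory Submission
  imports Defs
begin

text \<open>
  The index can be read off from any restriction of \<open>f\<close> to a bijection between cofinite
  sets: if \<open>A\<close> is cofinite, \<open>f\<close> is injective on \<open>A\<close> and \<open>f(A)\<close> is cofinite, then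
  \<open>ind f = |\<Omega> - A| - |\<Omega> - f(A)|\<close> (lemma \<open>ind_eq_defect\<close>). The right-hand side does not change
  when \<open>A\<close> shrinks by finitely many points, because \<open>f(A)\<close> shrinks by equally many; so by
  passing to intersections it is the same for all such \<open>A\<close>, and for the monoset it is the
  defining formula of \<open>ind f\<close>.

  Both claims then follow by choosing \<open>A\<close> well. Two almost equal near-bijections coincide on a
  common \<open>A\<close>, so they have the same index (\<open>ind_cong\<close>). For a composite \<open>g \<circ> f\<close>, choose \<open>A\<close>
  so small that \<open>f\<close> is injective on \<open>A\<close> and \<open>g\<close> is injective on \<open>f(A)\<close>; then
  \<open>|\<Omega> - A| - |\<Omega> - g(f(A))|\<close> telescopes through \<open>|\<Omega> - f(A)|\<close> into the sum of the two indices
  (\<open>near_bijections_compose\<close>).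

  The group axioms come down to two facts: composition respects almost equality, because
  near-bijections pull finite sets back to finite sets (\<open>almost_equal_compose\<close>), and inverting a
  bijection between cofinite sets yields an inverse class (\<open>near_bijection_left_inverse\<close>).
\<close>

section \<open>The index as a defect of a cofinite bijection\<close>

definition bijective_core :: "'a set \<Rightarrow> ('a \<Rightarrow> 'a) \<Rightarrow> 'a set \<Rightarrow> bool" where
  "bijective_core \<Omega> f A \<longleftrightarrow>
     A \<subseteq> \<Omega> \<and> finite (\<Omega> - A) \<and> inj_on f A \<and> f ` A \<subseteq> \<Omega> \<and> finite (\<Omega> - f ` A)"

definition defect :: "'a set \<Rightarrow> ('a \<Rightarrow> 'a) \<Rightarrow> 'a set \<Rightarrow> int" where
  "defect \<Omega> f A = int (card (\<Omega> - A)) - int (card (\<Omega> - f ` A))"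

lemma near_bijections_iff:
  "f \<in> near_bijections \<Omega> \<longleftrightarrow> f \<in> \<Omega> \<rightarrow>\<^sub>E \<Omega> \<and> (\<exists>A. bijective_core \<Omega> f A)"
  unfolding near_bijections_def bijective_core_def cofinite_in_def bij_betw_def by blast

lemma bijective_core_subset:
  assumes "bijective_core \<Omega> f A" "A' \<subseteq> A" "finite (\<Omega> - A')"
  shows "bijective_core \<Omega> f A'"
proof -
  have "\<Omega> - f ` A' \<subseteq> (\<Omega> - f ` A) \<union> f ` (\<Omega> - A')"
    using assms(1) unfolding bijective_core_def by blast
  moreover have "finite ((\<Omega> - f ` A) \<union> f ` (\<Omega> - A'))"
    using assms unfolding bijective_core_def by simp
  ultimately have "finite (\<Omega> - f ` A')"
    by (rule finite_subset)
  then show ?thesis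
    using assms unfolding bijective_core_def by (auto intro: inj_on_subset)
qed

text \<open>Injectivity makes \<open>A\<close> and \<open>f(A)\<close> lose the same number of points.\<close>

lemma defect_subset:
  assumes A: "bijective_core \<Omega> f A" and sub: "A' \<subseteq> A" and fin: "finite (\<Omega> - A')"
  shows "defect \<Omega> f A' = defect \<Omega> f A"
proof -
  have inj: "inj_on f A" and AO: "A \<subseteq> \<Omega>" and fAO: "f ` A \<subseteq> \<Omega>"
    and finA: "finite (\<Omega> - A)" and finfA: "finite (\<Omega> - f ` A)"
    using A by (auto simp: bijective_core_def)
  have finD: "finite (A - A')"
    using fin AO by (auto intro: finite_subset[of _ "\<Omega> - A'"])
  have "card (\<Omega> - A') = card ((\<Omega> - A) \<union> (A - A'))"
    using sub AO by (auto intro: arg_cong[where f = card])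
  also have "\<dots> = card (\<Omega> - A) + card (A - A')"
    using finA finD by (intro card_Un_disjoint) auto
  finally have dom: "card (\<Omega> - A') = card (\<Omega> - A) + card (A - A')" .
  have "\<Omega> - f ` A' = (\<Omega> - f ` A) \<union> f ` (A - A')"
    using sub fAO inj inj_on_image_set_diff[OF inj, of A A'] by auto
  then have "card (\<Omega> - f ` A') = card ((\<Omega> - f ` A) \<union> f ` (A - A'))"
    by simp
  also have "\<dots> = card (\<Omega> - f ` A) + card (f ` (A - A'))"
    using finfA finD by (intro card_Un_disjoint) auto
  also have "card (f ` (A - A')) = card (A - A')"
    using inj by (intro card_image inj_on_subset[OF inj]) auto
  finally show ?thesis
    using dom by (simp add: defect_def)
qed

lemma defect_unique:
  assumes "bijective_core \<Omega> f A" "bijective_core \<Omega> f B"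
  shows "defect \<Omega> f A = defect \<Omega> f B"
proof -
  have "finite (\<Omega> - A \<inter> B)"
    using assms by (simp add: bijective_core_def Diff_Int)
  then show ?thesis
    using defect_subset[OF assms(1), of "A \<inter> B"] defect_subset[OF assms(2), of "A \<inter> B"] by simp
qed

lemma near_bijection_finite_preimage:
  assumes "f \<in> near_bijections \<Omega>" "finite D"
  shows "finite {\<omega> \<in> \<Omega>. f \<omega> \<in> D}"
proof -
  obtain A where A: "finite (\<Omega> - A)" "inj_on f A"
    using assms(1) by (auto simp: near_bijections_iff bijective_core_def)
  have "finite (f -` D \<inter> A)"
    using assms(2) A(2) by (rule finite_vimage_IntI)
  with A(1) have "finite ((\<Omega> - A) \<union> (f -` D \<inter> A))"
    by simp
  then show ?thesis
    by (rule finite_subset[rotated]) auto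
qed

lemma mem_monoset_iff:
  "\<omega> \<in> monoset \<Omega> f \<longleftrightarrow> \<omega> \<in> \<Omega> \<and> (\<forall>\<omega>'\<in>\<Omega>. f \<omega>' = f \<omega> \<longrightarrow> \<omega>' = \<omega>)"
  unfolding monoset_def by blast

text \<open>A point of a bijective core \<open>A\<close> that lies outside the monoset shares its value with a
  point of the finite set \<open>\<Omega> - A\<close>, so there are only finitely many such points.\<close>

lemma bijective_core_monoset:
  assumes f: "f \<in> near_bijections \<Omega>"
  shows "bijective_core \<Omega> f (monoset \<Omega> f)"
proof -
  obtain A where fO: "f \<in> \<Omega> \<rightarrow>\<^sub>E \<Omega>" and A: "bijective_core \<Omega> f A"
    using f by (auto simp: near_bijections_iff)
  have inj: "inj_on f A" and finA: "finite (\<Omega> - A)"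
    using A by (auto simp: bijective_core_def)
  have "\<Omega> - monoset \<Omega> f \<subseteq> (\<Omega> - A) \<union> {\<omega> \<in> \<Omega>. f \<omega> \<in> f ` (\<Omega> - A)}"
  proof
    fix x
    assume "x \<in> \<Omega> - monoset \<Omega> f"
    then obtain y where "x \<in> \<Omega>" "y \<in> \<Omega>" "f y = f x" "y \<noteq> x"
      by (auto simp: mem_monoset_iff)
    with inj show "x \<in> (\<Omega> - A) \<union> {\<omega> \<in> \<Omega>. f \<omega> \<in> f ` (\<Omega> - A)}"
      by (cases "y \<in> A") (auto dest: inj_onD intro: rev_image_eqI)
  qed
  moreover have "finite ((\<Omega> - A) \<union> {\<omega> \<in> \<Omega>. f \<omega> \<in> f ` (\<Omega> - A)})"
    using finA near_bijection_finite_preimage[OF f] by simp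
  ultimately have fin: "finite (\<Omega> - monoset \<Omega> f)"
    by (rule finite_subset)
  have sub: "monoset \<Omega> f \<subseteq> \<Omega>"
    by (auto simp: mem_monoset_iff)
  have "finite (\<Omega> - A \<inter> monoset \<Omega> f)"
    using finA fin by (simp add: Diff_Int)
  then have "bijective_core \<Omega> f (A \<inter> monoset \<Omega> f)"
    using bijective_core_subset[OF A] by blast
  then have "finite (\<Omega> - f ` (A \<inter> monoset \<Omega> f))"
    by (simp add: bijective_core_def)
  then have "finite (\<Omega> - f ` monoset \<Omega> f)"
    by (rule finite_subset[rotated]) blast
  moreover have "inj_on f (monoset \<Omega> f)"
    by (simp add: mem_monoset_iff inj_on_def)
  ultimately show ?thesis
    using fin sub fO unfolding bijective_core_def by auto
qed

text \<open>Values taken on the monoset are not taken anywhere else, so the complement of its image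
  splits into \<open>\<Omega> - f(\<Omega>)\<close> and the image of its complement. This matches the three terms of
  \<^const>\<open>ind\<close> with the defect of the monoset.\<close>

lemma ind_eq_defect:
  assumes f: "f \<in> near_bijections \<Omega>" and A: "bijective_core \<Omega> f A"
  shows "ind \<Omega> f = defect \<Omega> f A"
proof -
  let ?M = "monoset \<Omega> f"
  have M: "bijective_core \<Omega> f ?M"
    using f by (rule bijective_core_monoset)
  have fO: "f \<in> \<Omega> \<rightarrow>\<^sub>E \<Omega>"
    using f by (simp add: near_bijections_iff)
  have split: "\<Omega> - f ` ?M = (\<Omega> - f ` \<Omega>) \<union> f ` (\<Omega> - ?M)"
    using fO by (auto simp: mem_monoset_iff) metis
  have "finite (\<Omega> - f ` ?M)"
    using M by (simp add: bijective_core_def)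
  then have "finite (\<Omega> - f ` \<Omega>)" "finite (f ` (\<Omega> - ?M))"
    unfolding split by simp_all
  then have "card (\<Omega> - f ` ?M) = card (\<Omega> - f ` \<Omega>) + card (f ` (\<Omega> - ?M))"
    unfolding split by (intro card_Un_disjoint) auto
  then have "ind \<Omega> f = defect \<Omega> f ?M"
    by (simp add: ind_def defect_def)
  also have "\<dots> = defect \<Omega> f A"
    using M A by (rule defect_unique)
  finally show ?thesis .
qed

section \<open>Almost equality and composition\<close>

lemma equiv_almost_equal: "equiv (\<Omega> \<rightarrow>\<^sub>E \<Omega>) (almost_equal \<Omega>)"
proof (rule equivI)
  show "almost_equal \<Omega> \<subseteq> (\<Omega> \<rightarrow>\<^sub>E \<Omega>) \<times> (\<Omega> \<rightarrow>\<^sub>E \<Omega>)"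
    by (auto simp: almost_equal_def)
  show "refl_on (\<Omega> \<rightarrow>\<^sub>E \<Omega>) (almost_equal \<Omega>)"
    by (auto simp: refl_on_def almost_equal_def)
  show "sym (almost_equal \<Omega>)"
    by (auto simp: sym_def almost_equal_def eq_commute)
  show "trans (almost_equal \<Omega>)"
  proof (rule transI)
    fix f g h
    assume fg: "(f, g) \<in> almost_equal \<Omega>" and gh: "(g, h) \<in> almost_equal \<Omega>"
    then have "finite ({\<omega> \<in> \<Omega>. f \<omega> \<noteq> g \<omega>} \<union> {\<omega> \<in> \<Omega>. g \<omega> \<noteq> h \<omega>})"
      by (simp add: almost_equal_def)
    then have "finite {\<omega> \<in> \<Omega>. f \<omega> \<noteq> h \<omega>}"
      by (rule finite_subset[rotated]) auto
    with fg gh show "(f, h) \<in> almost_equal \<Omega>"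
      by (simp add: almost_equal_def)
  qed
qed

lemma ae_class_eqI:
  "(f, g) \<in> almost_equal \<Omega> \<Longrightarrow> ae_class \<Omega> f = ae_class \<Omega> g"
  unfolding ae_class_def by (rule equiv_class_eq[OF equiv_almost_equal])

lemma mem_ae_class_iff: "g \<in> ae_class \<Omega> f \<longleftrightarrow> (f, g) \<in> almost_equal \<Omega>"
  by (simp add: ae_class_def)

lemma near_bijection_in_ae_class: "f \<in> near_bijections \<Omega> \<Longrightarrow> f \<in> ae_class \<Omega> f"
  by (auto simp: mem_ae_class_iff almost_equal_def near_bijections_def)

lemma almost_equal_common_core:
  assumes f: "f \<in> near_bijections \<Omega>" and ae: "(f, g) \<in> almost_equal \<Omega>"
  obtains A where "bijective_core \<Omega> f A" "bijective_core \<Omega> g A" "f ` A = g ` A"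
proof -
  obtain A where A: "bijective_core \<Omega> f A"
    using f by (auto simp: near_bijections_iff)
  let ?A = "A \<inter> {\<omega> \<in> \<Omega>. f \<omega> = g \<omega>}"
  have "\<Omega> - ?A \<subseteq> (\<Omega> - A) \<union> {\<omega> \<in> \<Omega>. f \<omega> \<noteq> g \<omega>}"
    by blast
  moreover have "finite ((\<Omega> - A) \<union> {\<omega> \<in> \<Omega>. f \<omega> \<noteq> g \<omega>})"
    using A ae by (simp add: bijective_core_def almost_equal_def)
  ultimately have "finite (\<Omega> - ?A)"
    by (rule finite_subset)
  then have core: "bijective_core \<Omega> f ?A"
    by (intro bijective_core_subset[OF A]) auto
  have img: "f ` ?A = g ` ?A"
    by (rule image_cong) auto
  have "inj_on f ?A \<longleftrightarrow> inj_on g ?A"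
    by (rule inj_on_cong) auto
  with core img have "bijective_core \<Omega> g ?A"
    by (simp add: bijective_core_def)
  with core show ?thesis
    using img by (rule that)
qed

lemma near_bijections_cong:
  assumes "f \<in> near_bijections \<Omega>" "(f, g) \<in> almost_equal \<Omega>"
  shows "g \<in> near_bijections \<Omega>"
proof -
  obtain A where "bijective_core \<Omega> g A"
    using almost_equal_common_core[OF assms] .
  with assms(2) show ?thesis
    by (auto simp: near_bijections_iff almost_equal_def)
qed

lemma ind_cong:
  assumes f: "f \<in> near_bijections \<Omega>" and ae: "(f, g) \<in> almost_equal \<Omega>"
  shows "ind \<Omega> g = ind \<Omega> f"
proof -
  obtain A where A: "bijective_core \<Omega> f A" "bijective_core \<Omega> g A" "f ` A = g ` A"
    using almost_equal_common_core[OF f ae] .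
  show ?thesis
    using ind_eq_defect[OF f A(1)] ind_eq_defect[OF near_bijections_cong[OF f ae] A(2)] A(3)
    by (simp add: defect_def)
qed

lemma Ind_ae_class:
  assumes f: "f \<in> near_bijections \<Omega>"
  shows "Ind \<Omega> (ae_class \<Omega> f) = ind \<Omega> f"
proof -
  have "ind \<Omega> g = ind \<Omega> f" if "g \<in> ae_class \<Omega> f" for g
    using f that unfolding mem_ae_class_iff by (rule ind_cong)
  then have "ind \<Omega> ` ae_class \<Omega> f = {ind \<Omega> f}"
    using near_bijection_in_ae_class[OF f] by blast
  then show ?thesis
    by (simp add: Ind_def)
qed

lemma near_bijections_compose:
  assumes f: "f \<in> near_bijections \<Omega>" and g: "g \<in> near_bijections \<Omega>"
  shows compose_in_near_bijections: "compose \<Omega> g f \<in> near_bijections \<Omega>"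
    and ind_compose: "ind \<Omega> (compose \<Omega> g f) = ind \<Omega> g + ind \<Omega> f"
proof -
  obtain A B where A: "bijective_core \<Omega> f A" and B: "bijective_core \<Omega> g B"
    using f g by (auto simp: near_bijections_iff)
  define A' where "A' = {a \<in> A. f a \<in> B}"
  have fO: "f \<in> \<Omega> \<rightarrow>\<^sub>E \<Omega>" and gO: "g \<in> \<Omega> \<rightarrow>\<^sub>E \<Omega>"
    using f g by (auto simp: near_bijections_iff)
  have "\<Omega> - A' \<subseteq> (\<Omega> - A) \<union> {\<omega> \<in> \<Omega>. f \<omega> \<in> \<Omega> - B}"
    using fO by (auto simp: A'_def)
  moreover have "finite ((\<Omega> - A) \<union> {\<omega> \<in> \<Omega>. f \<omega> \<in> \<Omega> - B})"
    using A B near_bijection_finite_preimage[OF f, of "\<Omega> - B"] by (simp add: bijective_core_def)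
  ultimately have "finite (\<Omega> - A')"
    by (rule finite_subset)
  then have A': "bijective_core \<Omega> f A'"
    by (intro bijective_core_subset[OF A]) (auto simp: A'_def)
  then have B': "bijective_core \<Omega> g (f ` A')"
    by (intro bijective_core_subset[OF B]) (auto simp: A'_def bijective_core_def)
  have A'O: "A' \<subseteq> \<Omega>"
    using A' by (simp add: bijective_core_def)
  have img: "compose \<Omega> g f ` A' = g ` f ` A'"
    using A'O by (auto simp: compose_def image_iff)
  have "inj_on (compose \<Omega> g f) A' \<longleftrightarrow> inj_on (g \<circ> f) A'"
    using A'O by (intro inj_on_cong) (auto simp: compose_def)
  then have core: "bijective_core \<Omega> (compose \<Omega> g f) A'"
    using A' B' img by (auto simp: bijective_core_def intro: comp_inj_on)
  have "compose \<Omega> g f \<in> \<Omega> \<rightarrow>\<^sub>E \<Omega>"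
    using fO gO by (auto simp: compose_def)
  with core show nb: "compose \<Omega> g f \<in> near_bijections \<Omega>"
    by (auto simp: near_bijections_iff)
  show "ind \<Omega> (compose \<Omega> g f) = ind \<Omega> g + ind \<Omega> f"
    using ind_eq_defect[OF nb core] ind_eq_defect[OF f A'] ind_eq_defect[OF g B'] img
    by (simp add: defect_def)
qed

text \<open>The two composites can differ only where \<open>f\<close> and \<open>f'\<close> differ, or where \<open>f\<close> takes one of
  the finitely many values at which \<open>g\<close> and \<open>g'\<close> differ.\<close>

lemma almost_equal_compose:
  assumes f: "f \<in> near_bijections \<Omega>"
    and ff': "(f, f') \<in> almost_equal \<Omega>" and gg': "(g, g') \<in> almost_equal \<Omega>"
  shows "(compose \<Omega> g f, compose \<Omega> g' f') \<in> almost_equal \<Omega>"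
proof -
  let ?D = "{\<omega> \<in> \<Omega>. g \<omega> \<noteq> g' \<omega>}"
  have fO: "f \<in> \<Omega> \<rightarrow>\<^sub>E \<Omega>" and f'O: "f' \<in> \<Omega> \<rightarrow>\<^sub>E \<Omega>"
    and gO: "g \<in> \<Omega> \<rightarrow>\<^sub>E \<Omega>" and g'O: "g' \<in> \<Omega> \<rightarrow>\<^sub>E \<Omega>"
    using ff' gg' by (auto simp: almost_equal_def)
  have "{\<omega> \<in> \<Omega>. compose \<Omega> g f \<omega> \<noteq> compose \<Omega> g' f' \<omega>}
      \<subseteq> {\<omega> \<in> \<Omega>. f \<omega> \<noteq> f' \<omega>} \<union> {\<omega> \<in> \<Omega>. f \<omega> \<in> ?D}"
    using fO by (auto simp: compose_def)
  moreover have "finite ({\<omega> \<in> \<Omega>. f \<omega> \<noteq> f' \<omega>} \<union> {\<omega> \<in> \<Omega>. f \<omega> \<in> ?D})"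
    using ff' gg' near_bijection_finite_preimage[OF f, of ?D] by (simp add: almost_equal_def)
  ultimately have "finite {\<omega> \<in> \<Omega>. compose \<Omega> g f \<omega> \<noteq> compose \<Omega> g' f' \<omega>}"
    by (rule finite_subset)
  moreover have "compose \<Omega> g f \<in> \<Omega> \<rightarrow>\<^sub>E \<Omega>" "compose \<Omega> g' f' \<in> \<Omega> \<rightarrow>\<^sub>E \<Omega>"
    using fO f'O gO g'O by (auto simp: compose_def)
  ultimately show ?thesis
    by (simp add: almost_equal_def)
qed

section \<open>The group of almost-equality classes\<close>

lemma mult_ae_class:
  assumes f: "f \<in> near_bijections \<Omega>" and g: "g \<in> near_bijections \<Omega>"
  shows "ae_class \<Omega> g \<otimes>\<^bsub>near_bij_group \<Omega>\<^esub> ae_class \<Omega> f = ae_class \<Omega> (compose \<Omega> g f)"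
proof -
  have "ae_class \<Omega> (compose \<Omega> g' f') = ae_class \<Omega> (compose \<Omega> g f)"
    if "g' \<in> ae_class \<Omega> g" "f' \<in> ae_class \<Omega> f" for f' g'
    using that ae_class_eqI[OF almost_equal_compose[OF f, of f' g g']]
    by (simp add: mem_ae_class_iff)
  then have "(\<Union>g'\<in>ae_class \<Omega> g. \<Union>f'\<in>ae_class \<Omega> f. ae_class \<Omega> (compose \<Omega> g' f'))
      = ae_class \<Omega> (compose \<Omega> g f)"
    using near_bijection_in_ae_class[OF f] near_bijection_in_ae_class[OF g] by blast
  then show ?thesis
    by (simp add: near_bij_group_def)
qed

lemma id_in_near_bijections: "(\<lambda>\<omega>\<in>\<Omega>. \<omega>) \<in> near_bijections \<Omega>"
proof -
  have "bijective_core \<Omega> (\<lambda>\<omega>\<in>\<Omega>. \<omega>) \<Omega>"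
    by (auto simp: bijective_core_def inj_on_def)
  then show ?thesis
    by (auto simp: near_bijections_iff)
qed

lemma near_bijection_left_inverse:
  assumes f: "f \<in> near_bijections \<Omega>"
  obtains g where "g \<in> near_bijections \<Omega>"
    and "(compose \<Omega> g f, \<lambda>\<omega>\<in>\<Omega>. \<omega>) \<in> almost_equal \<Omega>"
proof -
  obtain A where fO: "f \<in> \<Omega> \<rightarrow>\<^sub>E \<Omega>" and A: "bijective_core \<Omega> f A"
    using f by (auto simp: near_bijections_iff)
  have inj: "inj_on f A" and AO: "A \<subseteq> \<Omega>" and fAO: "f ` A \<subseteq> \<Omega>"
    and finA: "finite (\<Omega> - A)" and finfA: "finite (\<Omega> - f ` A)"
    using A by (auto simp: bijective_core_def)
  \<comment> \<open>Off the finite set \<open>\<Omega> - f(A)\<close> this inverts \<open>f\<close>; on it any values in \<open>\<Omega>\<close> would do.\<close>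
  define g where "g = (\<lambda>\<omega>\<in>\<Omega>. if \<omega> \<in> f ` A then inv_into A f \<omega> else \<omega>)"
  have gf: "g (f a) = a" if "a \<in> A" for a
    using that inj fAO by (auto simp: g_def)
  have gO: "g \<in> \<Omega> \<rightarrow>\<^sub>E \<Omega>"
    using subsetD[OF AO] inj by (auto simp: g_def)
  have img: "g ` f ` A = A"
    using gf by (simp add: image_image cong: image_cong)
  have "inj_on g (f ` A)"
    using gf by (auto intro: inj_on_inverseI[where g = f])
  with img finA finfA AO fAO have "bijective_core \<Omega> g (f ` A)"
    by (simp add: bijective_core_def)
  with gO have nb: "g \<in> near_bijections \<Omega>"
    by (auto simp: near_bijections_iff)
  have "{\<omega> \<in> \<Omega>. compose \<Omega> g f \<omega> \<noteq> (\<lambda>\<omega>\<in>\<Omega>. \<omega>) \<omega>} \<subseteq> \<Omega> - A"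
    using gf by (auto simp: compose_def)
  then have "finite {\<omega> \<in> \<Omega>. compose \<Omega> g f \<omega> \<noteq> (\<lambda>\<omega>\<in>\<Omega>. \<omega>) \<omega>}"
    using finA by (rule finite_subset)
  moreover have "compose \<Omega> g f \<in> \<Omega> \<rightarrow>\<^sub>E \<Omega>"
    using fO gO by (auto simp: compose_def)
  ultimately have "(compose \<Omega> g f, \<lambda>\<omega>\<in>\<Omega>. \<omega>) \<in> almost_equal \<Omega>"
    by (auto simp: almost_equal_def)
  with nb show ?thesis
    by (rule that)
qed

lemma carrier_near_bij_group: "carrier (near_bij_group \<Omega>) = ae_class \<Omega> ` near_bijections \<Omega>"
  by (simp add: near_bij_group_def)

lemma one_near_bij_group: "\<one>\<^bsub>near_bij_group \<Omega>\<^esub> = ae_class \<Omega> (\<lambda>\<omega>\<in>\<Omega>. \<omega>)"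
  by (simp add: near_bij_group_def)

lemma group_near_bij_group: "group (near_bij_group \<Omega>)"
proof (rule groupI, unfold carrier_near_bij_group one_near_bij_group)
  let ?G = "near_bij_group \<Omega>"
  fix X Y
  assume "X \<in> ae_class \<Omega> ` near_bijections \<Omega>" "Y \<in> ae_class \<Omega> ` near_bijections \<Omega>"
  then show "X \<otimes>\<^bsub>?G\<^esub> Y \<in> ae_class \<Omega> ` near_bijections \<Omega>"
    by (auto simp: mult_ae_class compose_in_near_bijections)
next
  show "ae_class \<Omega> (\<lambda>\<omega>\<in>\<Omega>. \<omega>) \<in> ae_class \<Omega> ` near_bijections \<Omega>"
    using id_in_near_bijections by (rule imageI)
next
  let ?G = "near_bij_group \<Omega>"
  fix X Y Z
  assume "X \<in> ae_class \<Omega> ` near_bijections \<Omega>" "Y \<in> ae_class \<Omega> ` near_bijections \<Omega>"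
    "Z \<in> ae_class \<Omega> ` near_bijections \<Omega>"
  then obtain h g f where h: "h \<in> near_bijections \<Omega>" "X = ae_class \<Omega> h"
    and g: "g \<in> near_bijections \<Omega>" "Y = ae_class \<Omega> g"
    and f: "f \<in> near_bijections \<Omega>" "Z = ae_class \<Omega> f"
    by blast
  have "f \<in> \<Omega> \<rightarrow> \<Omega>"
    using f by (auto simp: near_bijections_def)
  then have "compose \<Omega> (compose \<Omega> h g) f = compose \<Omega> h (compose \<Omega> g f)"
    using compose_assoc[of f \<Omega> \<Omega> h g] by simp
  then show "X \<otimes>\<^bsub>?G\<^esub> Y \<otimes>\<^bsub>?G\<^esub> Z = X \<otimes>\<^bsub>?G\<^esub> (Y \<otimes>\<^bsub>?G\<^esub> Z)"
    using h g f by (simp add: mult_ae_class compose_in_near_bijections)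
next
  let ?G = "near_bij_group \<Omega>"
  fix X
  assume "X \<in> ae_class \<Omega> ` near_bijections \<Omega>"
  then obtain f where f: "f \<in> near_bijections \<Omega>" "X = ae_class \<Omega> f"
    by blast
  have "compose \<Omega> (\<lambda>\<omega>\<in>\<Omega>. \<omega>) f = f"
    using f(1) by (intro Id_compose) (auto simp: near_bijections_def PiE_def)
  then show "ae_class \<Omega> (\<lambda>\<omega>\<in>\<Omega>. \<omega>) \<otimes>\<^bsub>?G\<^esub> X = X"
    using f mult_ae_class[OF f(1) id_in_near_bijections] by simp
  obtain g where g: "g \<in> near_bijections \<Omega>"
    and inv: "(compose \<Omega> g f, \<lambda>\<omega>\<in>\<Omega>. \<omega>) \<in> almost_equal \<Omega>"
    using near_bijection_left_inverse[OF f(1)] .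
  then have "ae_class \<Omega> g \<otimes>\<^bsub>?G\<^esub> X = ae_class \<Omega> (\<lambda>\<omega>\<in>\<Omega>. \<omega>)"
    using f mult_ae_class[OF f(1) g] ae_class_eqI[OF inv] by simp
  with g show "\<exists>Y\<in>ae_class \<Omega> ` near_bijections \<Omega>. Y \<otimes>\<^bsub>?G\<^esub> X = ae_class \<Omega> (\<lambda>\<omega>\<in>\<Omega>. \<omega>)"
    by blast
qed

theorem theorem27:
  fixes \<Omega> :: "'a set"
  assumes "infinite \<Omega>"
  shows "(\<forall>f\<in>near_bijections \<Omega>. Ind \<Omega> (ae_class \<Omega> f) = ind \<Omega> f)
    \<and> group_hom (near_bij_group \<Omega>) integer_group (Ind \<Omega>)"
proof
  show "\<forall>f\<in>near_bijections \<Omega>. Ind \<Omega> (ae_class \<Omega> f) = ind \<Omega> f"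
    by (simp add: Ind_ae_class)
  have "Ind \<Omega> \<in> hom (near_bij_group \<Omega>) integer_group"
    by (auto simp: hom_def carrier_near_bij_group mult_ae_class Ind_ae_class
        compose_in_near_bijections ind_compose)
  then show "group_hom (near_bij_group \<Omega>) integer_group (Ind \<Omega>)"
    by (intro group_hom.intro group_near_bij_group group_integer_group group_hom_axioms.intro)
qed

end
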